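(* Let $q$ be a prime power, let $\ell, N$ be positive integers, and let $n = \ell N$ be a sum-rank length partition with equal sublengths $N = n_1 = \cdots = n_\ell$ (extension degree $m=1$). Let $r \geq N$, and let $s \geq 0$ be the remainder of $r$ divided by $N$. If $\mathcal{C} \subseteq \mathbb{F}_q^n$ is a proper sum-rank Hamming code with $r = n - \dim(\mathcal{C})$, then $$ N\left( \frac{q^r - q^s}{q^N - 1} - q^s + 1 \right) \leq n \leq N\, \frac{q^r - q^s}{q^N-1}, $$ and equality holds (in both inequalities) if $s = 0$.
   Context: Sum-rank metric for $m=1$: for $\mathbf{c} = (\mathbf{c}^{(1)}, \ldots, \mathbf{c}^{(\ell)}) \in \mathbb{F}_q^n$ with $\mathbf{c}^{(i)} \in \mathbb{F}_q^{N}$, the sum-rank weight is $\mathrm{wt}_{SR}(\mathbf{c}) = \sum_{i=1}^\ell \mathrm{Rk}(\mathbf{c}^{(i)})$, where $\mathbf{c}^{(i)}$ is viewed as a $1\times N$ matrix over $\mathbb{F}_q$ (so the weight is the number of nonzero blocks). For a linear code (subspace) $\mathcal{C}$, $\mathrm{d}_{SR}(\mathcal{C}) = \min\{\mathrm{wt}_{SR}(\mathbf{c}) \mid \mathbf{c} \in \mathcal{C}\setminus\{\mathbf{0}\}\}$. Proper sum-rank Hamming code ($m=1$): a linear code $\mathcal{C} \subseteq \mathbb{F}_q^n$, $n = \ell N$, of redundancy $r = n - \dim(\mathcal{C})$, such that $\mathrm{d}_{SR}(\mathcal{C}) \geq 3$ and there is no linear code $\mathcal{C}' \subseteq \mathbb{F}_q^{n'}$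 with $\mathrm{d}_{SR}(\mathcal{C}') \geq 3$ and $n' - \dim(\mathcal{C}') = r$ for a partition $n' = \ell' N$ into $\ell'$ blocks of the same length $N$ with $\ell' > \ell$. *)

theory Defs
  imports "Jordan_Normal_Form.DL_Rank" "HOL-Library.Extended_Nat"
begin

definition linear_code :: "nat \<Rightarrow> 'a::field vec set \<Rightarrow> bool" where
  "linear_code n C \<longleftrightarrow> VectorSpace.subspace class_ring C (module_vec TYPE('a) n)"

definition code_dim :: "nat \<Rightarrow> 'a::field vec set \<Rightarrow> nat" where
  "code_dim n C = vectorspace.dim class_ring ((module_vec TYPE('a) n)\<lparr>carrier := C\<rparr>)"

text \<open>The subtraction of naturals is harmless: a linear code of length \<open>n\<close> has dimension
  at most \<open>n\<close>.\<close>

definition redundancy :: "nat \<Rightarrow> 'a::field vec set \<Rightarrow> nat" where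
  "redundancy n C = n - code_dim n C"

text \<open>A vector of length \<open>l * N\<close> is read as \<open>l\<close> consecutive blocks of length \<open>N\<close>, with blocks
  counted from \<open>0\<close>.\<close>

definition block :: "nat \<Rightarrow> 'a vec \<Rightarrow> nat \<Rightarrow> 'a vec" where
  "block N c i = vec N (\<lambda>j. c $ (i * N + j))"

text \<open>Extension degree \<open>1\<close>: each block is a \<open>1 \<times> N\<close> matrix. The first argument of
  \<^const>\<open>vec_space.rank\<close> is the number of rows.\<close>

definition wt_SR :: "nat \<Rightarrow> nat \<Rightarrow> 'a::field vec \<Rightarrow> nat" where
  "wt_SR l N c = (\<Sum>i<l. vec_space.rank 1 (mat_of_row (block N c i)))"

text \<open>The infimum of a nonempty set in \<^typ>\<open>enat\<close> is its minimum. The zero code has no nonzero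
  codeword, and its minimum distance is \<open>\<infinity>\<close> by convention.\<close>

definition d_SR :: "nat \<Rightarrow> nat \<Rightarrow> 'a::field vec set \<Rightarrow> enat" where
  "d_SR l N C = (INF c \<in> C - {0\<^sub>v (l * N)}. enat (wt_SR l N c))"

definition proper_sum_rank_Hamming_code :: "nat \<Rightarrow> nat \<Rightarrow> 'a::field vec set \<Rightarrow> bool" where
  "proper_sum_rank_Hamming_code l N C \<longleftrightarrow>
     linear_code (l * N) C \<and> d_SR l N C \<ge> 3 \<and>
     \<not> (\<exists>l' (C' :: 'a vec set). l' > l \<and> linear_code (l' * N) C' \<and> d_SR l' N C' \<ge> 3 \<and>
          redundancy (l' * N) C' = redundancy (l * N) C)"

end

(* The upper bound is sphere packing: the balls of radius 1 around codewords are disjoint and have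
   1 + l * (q^N - 1) elements. For the lower bound, a code with d >= 3 and redundancy r is the same as a
   partial spread spanning F_q^r, i.e. a family of N-dimensional subspaces meeting pairwise in 0. To
   construct one, write r = k * N + s and identify F_q^r with the product of the fields
   B_0, ..., B_(k-1), where B_i has q^N elements for i < k - 1 and B_(k-1) has q^(N+s). Fix F_q-linear
   embeddings theta_i of F_q^N into B_i. Every vector a with first nonzero entry 1 gives the subspace of
   all (a_i * theta_i(x))_i. There are 1 + sum_(0<i<k) q^(i*N+s) such vectors, which is the lower bound.
   For k = 1 and s > 0 the single subspace does not span, but then the lower bound is trivial. *)
theory Submission
  imports Defs "HOL-Algebra.Algebraic_Closure_Type" "HOL-Library.Cardinality"
begin

section \<open>Cardinality of linear codes\<close>

lemma card_field_gt_1: "card (UNIV :: 'a::{field,finite} set) > 1"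
  using card_mono[of UNIV "{0, 1 :: 'a}"] by simp

text \<open>Coordinates with respect to a finite basis \<open>B\<close> identify the space with the
  functions from \<open>B\<close> to the field. A basis exists because the finite carrier spans
  itself.\<close>

lemma (in vectorspace) card_carrier_eq_power_dim:
  assumes "finite (carrier K)" "finite (carrier V)"
  shows "card (carrier V) = card (carrier K) ^ dim"
proof -
  have "fin_dim"
    unfolding fin_dim_def using assms(2) span_is_subset2[of "carrier V"] in_own_span[of "carrier V"]
    by (intro exI[of _ "carrier V"]) auto
  then obtain B where B: "finite B" "basis B"
    using finite_basis_exists by blast
  then have BV: "B \<subseteq> carrier V"
    by (simp add: basis_def)
  have ex1: "\<exists>!a. a \<in> B \<rightarrow>\<^sub>E carrier K \<and> lincomb a B = v" if "v \<in> carrier V" for v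
    using basis_criterion[OF B(1) BV] B(2) that by blast
  have "bij_betw (\<lambda>a. lincomb a B) (B \<rightarrow>\<^sub>E carrier K) (carrier V)"
  proof (rule bij_betw_imageI)
    have "lincomb a B \<in> carrier V" if "a \<in> B \<rightarrow>\<^sub>E carrier K" for a
      using that BV by (intro lincomb_closed) auto
    then show "inj_on (\<lambda>a. lincomb a B) (B \<rightarrow>\<^sub>E carrier K)"
      and "(\<lambda>a. lincomb a B) ` (B \<rightarrow>\<^sub>E carrier K) = carrier V"
      using ex1 by (auto simp: inj_on_def) blast+
  qed
  then have "card (carrier V) = card (B \<rightarrow>\<^sub>E carrier K)"
    by (simp add: bij_betw_same_card)
  also have "\<dots> = card (carrier K) ^ dim"
    using B by (simp add: card_PiE dim_basis)
  finally show ?thesis .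
qed

lemma finite_carrier_vec: "finite (carrier_vec n :: 'a::finite vec set)"
proof (rule finite_subset)
  show "carrier_vec n \<subseteq> vec n ` ({..<n} \<rightarrow>\<^sub>E (UNIV :: 'a set))"
  proof
    fix v :: "'a vec" assume "v \<in> carrier_vec n"
    then show "v \<in> vec n ` ({..<n} \<rightarrow>\<^sub>E (UNIV :: 'a set))"
      by (intro image_eqI[of _ _ "restrict (($) v) {..<n}"]) auto
  qed
  show "finite (vec n ` ({..<n} \<rightarrow>\<^sub>E (UNIV :: 'a set)))"
    by (intro finite_imageI finite_PiE) auto
qed

lemma card_carrier_vec: "card (carrier_vec n :: 'a::{field,finite} vec set) = CARD('a) ^ n"
proof -
  have "finite (carrier (class_ring :: 'a ring))" "finite (carrier (module_vec TYPE('a) n))"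
    by (simp_all add: class_ring_simps module_vec_simps finite_carrier_vec)
  from vectorspace.card_carrier_eq_power_dim[OF vec_vs this] show ?thesis
    unfolding module_vec_simps class_ring_simps vec_space.dim_is_n .
qed

lemma linear_code_iff:
  "linear_code n (C :: 'a::field vec set) \<longleftrightarrow>
     C \<subseteq> carrier_vec n \<and> 0\<^sub>v n \<in> C \<and> (\<forall>x\<in>C. \<forall>y\<in>C. x + y \<in> C) \<and> (\<forall>a. \<forall>x\<in>C. a \<cdot>\<^sub>v x \<in> C)"
proof -
  have "linear_code n C \<longleftrightarrow> submodule class_ring C (module_vec TYPE('a) n)"
    unfolding linear_code_def VectorSpace.subspace_def using vec_vs by blast
  also have "\<dots> \<longleftrightarrow> C \<subseteq> carrier_vec n \<and> 0\<^sub>v n \<in> C \<and> (\<forall>x\<in>C. \<forall>y\<in>C. x + y \<in> C)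
      \<and> (\<forall>a. \<forall>x\<in>C. a \<cdot>\<^sub>v x \<in> C)"
    unfolding submodule_def module_vec_simps class_ring_simps using vec_module by blast
  finally show ?thesis .
qed

lemma card_linear_code:
  fixes C :: "'a::{field,finite} vec set"
  assumes "linear_code n C"
  shows "card C = CARD('a) ^ code_dim n C" "finite C"
proof -
  interpret vec_space "TYPE('a)" n .
  interpret C: vectorspace class_ring "vs C"
    using assms subspace_is_vs by (simp add: linear_code_def)
  show "finite C"
    using assms finite_carrier_vec finite_subset by (auto simp: linear_code_iff)
  then show "card C = CARD('a) ^ code_dim n C"
    using C.card_carrier_eq_power_dim by (simp add: code_dim_def class_ring_simps)
qed

text \<open>Redundancy is handled through this counting identity from here on. Comparing
  cardinalities shows \<open>code_dim n C \<le> n\<close>, so the subtraction in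
  \<open>redundancy\<close> does not truncate.\<close>

lemma card_linear_code_redundancy:
  fixes C :: "'a::{field,finite} vec set"
  assumes "linear_code n C"
  shows "card C * CARD('a) ^ redundancy n C = CARD('a) ^ n"
proof -
  have "card (UNIV :: 'a set) > 1"
    by (rule card_field_gt_1)
  moreover have "card C \<le> CARD('a) ^ n"
    using assms card_mono[of "carrier_vec n" C]
    by (simp add: linear_code_iff card_carrier_vec finite_carrier_vec)
  ultimately have "code_dim n C \<le> n"
    by (simp add: card_linear_code[OF assms])
  then show ?thesis
    by (simp add: card_linear_code[OF assms] redundancy_def flip: power_add)
qed

section \<open>Sum-rank weight as the number of nonzero blocks\<close>

lemma rank_mat_of_row:
  fixes v :: "'a::field vec"
  assumes v: "v \<in> carrier_vec N"
  shows "vec_space.rank 1 (mat_of_row v) = (if v = 0\<^sub>v N then 0 else 1)"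
proof -
  interpret vec_space "TYPE('a)" 1 .
  have le: "rank (mat_of_row v) \<le> 1"
    using v by (intro rank_le_1_product_entries[where f="\<lambda>_. 1" and g="($) v" and nc=N]) auto
  show ?thesis
  proof (cases "v = 0\<^sub>v N")
    case True
    then have "mat_of_row v = 0\<^sub>m 1 N" by auto
    then show ?thesis using True rank_0I by simp
  next
    case False
    with v obtain j where j: "j < N" "v $ j \<noteq> 0"
      by (metis carrier_vecD dim_vec eq_vecI index_zero_vec(1) zero_carrier_vec)
    \<comment> \<open>The column of a nonzero entry is an independent set of size one, so the rank
      is at least 1.\<close>
    let ?u = "col (mat_of_row v) j"
    have u: "?u \<in> carrier_vec 1"
      by (intro carrier_vecI) simp
    have "?u $ 0 = v $ j"
      using v j by simp
    then have u0: "?u \<noteq> 0\<^sub>v 1" using j by auto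
    have "lin_indpt {}"
      unfolding lin_dep_def by blast
    then have "lin_indpt {?u}"
      using lin_dep_iff_in_span[of "{}" ?u] u u0 unfolding span_empty by simp
    moreover have "?u \<in> set (cols (mat_of_row v))"
      using v j by (auto simp: cols_def)
    ultimately have "rank (mat_of_row v) \<ge> card {?u}"
      using v by (intro rank_ge_card_indpt[where nc=N]) auto
    then show ?thesis using le False by simp
  qed
qed

lemma wt_SR_eq_card:
  fixes c :: "'a::field vec"
  shows "wt_SR l N c = card {i. i < l \<and> block N c i \<noteq> 0\<^sub>v N}"
proof -
  have "wt_SR l N c = (\<Sum>i<l. if block N c i \<noteq> 0\<^sub>v N then 1 else 0)"
    unfolding wt_SR_def
    by (intro sum.cong refl, subst rank_mat_of_row[where N=N]) (simp_all add: block_def)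
  also have "\<dots> = card ({..<l} \<inter> {i. block N c i \<noteq> 0\<^sub>v N})"
    by (simp add: sum.If_cases)
  finally show ?thesis
    by (simp add: Int_def lessThan_def)
qed

lemma d_SR_ge_3_iff:
  "d_SR l N C \<ge> 3 \<longleftrightarrow> (\<forall>c\<in>C. c \<noteq> 0\<^sub>v (l * N) \<longrightarrow> wt_SR l N c \<ge> 3)"
  by (auto simp: d_SR_def le_INF_iff numeral_eq_enat)

section \<open>Finite fields inside the algebraic closure\<close>

text \<open>Translation by 1 permutes the field; comparing the sums of all elements before and after
  leaves q copies of 1 summing to 0.\<close>

lemma of_nat_card_field_eq_0: "of_nat CARD('a) = (0 :: 'a::{field,finite})"
proof -
  have "(\<Sum>x\<in>UNIV. x + 1 :: 'a) = (\<Sum>x\<in>UNIV. x)"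
    by (rule sum.reindex_bij_witness[of _ "\<lambda>x. x - 1" "\<lambda>x. x + 1"]) auto
  then show ?thesis by (simp add: sum.distrib)
qed

lemma of_nat_card_field_alg_closure_eq_0:
  "of_nat CARD('a::{field,finite}) = (0 :: 'a alg_closure)"
  using of_nat_card_field_eq_0[where ?'a = 'a] by (metis to_ac_0 to_ac_of_nat)

text \<open>Multiplication by a nonzero \<open>x\<close> permutes the nonzero elements, and their
  product can be cancelled.\<close>

lemma field_power_card_eq_same:
  fixes x :: "'a::{field,finite}"
  shows "x ^ CARD('a) = x"
proof (cases "x = 0")
  case True
  then show ?thesis using card_field_gt_1[where ?'a = 'a] by simp
next
  case False
  have "(\<Prod>y\<in>UNIV-{0}. x * y) = (\<Prod>y\<in>UNIV-{0}. y)"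
    by (rule prod.reindex_bij_witness[of _ "\<lambda>y. y / x" "\<lambda>y. x * y"]) (use False in auto)
  then have "x ^ (CARD('a) - 1) * (\<Prod>y\<in>UNIV-{0}. y) = (\<Prod>y\<in>UNIV-{0::'a}. y)"
    by (simp add: prod.distrib card_Diff_singleton)
  moreover have "(\<Prod>y\<in>UNIV-{0::'a}. y) \<noteq> 0"
    by simp
  ultimately have "x ^ (CARD('a) - 1) = 1"
    by simp
  then have "x ^ Suc (CARD('a) - 1) = x"
    by (simp only: power_Suc mult_1_right)
  also have "Suc (CARD('a) - 1) = CARD('a)"
    using card_field_gt_1[where ?'a = 'a] by linarith
  finally show ?thesis .
qed

text \<open>The middle terms of \<open>(z + 1) ^ q\<close> form a polynomial of degree below q that
  vanishes at the q elements of the base field, so it is zero. This gives additivity without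
  decomposing q as a prime power.\<close>

lemma alg_closure_power_card_add:
  fixes x y :: "'a::{field,finite} alg_closure"
  shows "(x + y) ^ CARD('a) = x ^ CARD('a) + y ^ CARD('a)"
proof -
  let ?q = "CARD('a)"
  let ?R = "\<Sum>i\<in>{1..<?q}. Polynomial.monom (of_nat (?q choose i) :: 'a alg_closure) i"
  have q1: "?q > 1"
    by (rule card_field_gt_1)
  have R: "poly ?R z = (z + 1) ^ ?q - z ^ ?q - 1" for z
  proof -
    have "{..?q} = insert 0 (insert ?q {1..<?q})"
      using q1 by auto
    then show ?thesis
      using q1 by (simp add: binomial_ring poly_sum poly_monom)
  qed
  have "?R = 0"
  proof (rule ccontr)
    assume nz: "?R \<noteq> 0"
    have "Polynomial.degree ?R < ?q"
      using q1 by (intro degree_sum_less) (auto intro: le_less_trans[OF degree_monom_le])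
    moreover have "range (to_ac :: 'a \<Rightarrow> _) \<subseteq> {z. poly ?R z = 0}"
    proof clarify
      fix a :: 'a
      have "(to_ac a + 1) ^ ?q = to_ac ((a + 1) ^ ?q)"
        by simp
      then have "(to_ac a + 1) ^ ?q = to_ac a + 1"
        unfolding field_power_card_eq_same by simp
      moreover have "to_ac a ^ ?q = to_ac a"
        by (simp add: field_power_card_eq_same flip: to_ac_power)
      ultimately show "poly ?R (to_ac a) = 0"
        unfolding R by simp
    qed
    then have "card (range (to_ac :: 'a \<Rightarrow> _)) \<le> card {z. poly ?R z = 0}"
      using nz by (intro card_mono poly_roots_finite)
    then have "?q \<le> Polynomial.degree ?R"
      using card_poly_roots_bound[OF nz] by (simp add: card_image inj_to_ac)
    ultimately show False by simp
  qed
  then have one: "(z + 1) ^ ?q = z ^ ?q + 1" for z :: "'a alg_closure"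
    using R[of z] by (simp add: algebra_simps)
  show ?thesis
  proof (cases "y = 0")
    case True
    then show ?thesis using q1 by simp
  next
    case False
    \<comment> \<open>Homogeneity reduces the general case to a second summand equal to 1.\<close>
    then have "x + y = (x / y + 1) * y"
      by (simp add: field_simps)
    then have "(x + y) ^ ?q = (x / y + 1) ^ ?q * y ^ ?q"
      by (simp only: power_mult_distrib)
    also have "\<dots> = x ^ ?q + y ^ ?q"
      unfolding one using False by (simp add: power_divide distrib_right)
    finally show ?thesis .
  qed
qed

lemma alg_closure_power_card_power_add:
  fixes x y :: "'a::{field,finite} alg_closure"
  shows "(x + y) ^ (CARD('a) ^ m) = x ^ (CARD('a) ^ m) + y ^ (CARD('a) ^ m)"
  by (induction m) (simp_all add: power_mult alg_closure_power_card_add mult.commute[of "CARD('a)"])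

text \<open>For \<open>m > 0\<close> this is the field with q^m elements, as the fixed points of a
  Frobenius power; for \<open>m = 0\<close> it is the whole closure. Working inside one closure lets
  fields of different sizes share a type.\<close>

definition subfield_ac :: "nat \<Rightarrow> 'a::{field,finite} alg_closure set" where
  "subfield_ac m = {x. x ^ (CARD('a) ^ m) = x}"

lemma subfield_ac_closed:
  fixes x y :: "'a::{field,finite} alg_closure"
  shows "to_ac (a :: 'a) \<in> subfield_ac m"
    and "0 \<in> (subfield_ac m :: 'a alg_closure set)"
    and "1 \<in> (subfield_ac m :: 'a alg_closure set)"
    and "x \<in> subfield_ac m \<Longrightarrow> y \<in> subfield_ac m \<Longrightarrow> x + y \<in> subfield_ac m"
    and "x \<in> subfield_ac m \<Longrightarrow> y \<in> subfield_ac m \<Longrightarrow> x - y \<in> subfield_ac m"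
    and "x \<in> subfield_ac m \<Longrightarrow> y \<in> subfield_ac m \<Longrightarrow> x * y \<in> subfield_ac m"
    and "x \<in> subfield_ac m \<Longrightarrow> y \<in> subfield_ac m \<Longrightarrow> x / y \<in> subfield_ac m"
proof -
  have ac: "to_ac a ^ (CARD('a) ^ m) = to_ac a" for a :: 'a
    by (induction m) (simp_all add: field_power_card_eq_same power_mult flip: to_ac_power)
  then show "to_ac (a :: 'a) \<in> subfield_ac m"
    by (simp add: subfield_ac_def)
  show "0 \<in> (subfield_ac m :: 'a alg_closure set)" "1 \<in> (subfield_ac m :: 'a alg_closure set)"
    by (simp_all add: subfield_ac_def)
  assume xy: "x \<in> subfield_ac m" "y \<in> subfield_ac m"
  then show "x + y \<in> subfield_ac m" "x * y \<in> subfield_ac m" "x / y \<in> subfield_ac m"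
    by (simp_all add: subfield_ac_def alg_closure_power_card_power_add power_mult_distrib power_divide)
  \<comment> \<open>Since the scalar -1 of the base field is fixed by the power map, no case
    distinction on the parity of q arises.\<close>
  have "x - y = x + to_ac (-1 :: 'a) * y"
    by simp
  also have "\<dots> \<in> subfield_ac m"
    using xy ac[of "-1"] unfolding subfield_ac_def mem_Collect_eq
      alg_closure_power_card_power_add power_mult_distrib by simp
  finally show "x - y \<in> subfield_ac m" .
qed

lemma subfield_ac_sum:
  "(\<And>i. i \<in> A \<Longrightarrow> f i \<in> subfield_ac m) \<Longrightarrow> sum f A \<in> subfield_ac m"
  by (induction A rule: infinite_finite_induct) (auto simp: subfield_ac_closed)

text \<open>The set consists of the roots of X^Q - X with Q = q^m. Its derivative is -1, so all
  roots are simple, and over an algebraically closed field there are exactly Q of them.\<close>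

lemma card_subfield_ac:
  assumes "m > 0"
  shows "card (subfield_ac m :: 'a::{field,finite} alg_closure set) = CARD('a) ^ m"
    and "finite (subfield_ac m :: 'a alg_closure set)"
proof -
  let ?Q = "CARD('a) ^ m"
  define P where "P = Polynomial.monom (1 :: 'a alg_closure) ?Q - [:0, 1:]"
  have Q1: "?Q > 1"
    using card_field_gt_1[where ?'a = 'a] assms by (intro one_less_power)
  have deg: "Polynomial.degree P = ?Q"
    unfolding P_def diff_conv_add_uminus using Q1
    by (subst degree_add_eq_left) (auto simp: degree_monom_eq)
  then have nz: "P \<noteq> 0"
    using Q1 by auto
  have Q0: "of_nat ?Q = (0 :: 'a alg_closure)"
    using assms by (simp add: of_nat_card_field_alg_closure_eq_0)
  have pd: "pderiv P = -1"
    unfolding P_def pderiv_diff pderiv_monom Q0 by (simp add: pderiv_pCons one_pCons)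
  have roots: "poly P x = 0 \<longleftrightarrow> x \<in> subfield_ac m" for x
    by (simp add: P_def poly_monom subfield_ac_def)
  have order_le: "order x P \<le> 1" for x
  proof (rule ccontr)
    assume "\<not> order x P \<le> 1"
    then have "[:-x, 1:] ^ 2 dvd P"
      by (intro dvd_trans[OF le_imp_power_dvd order_1]) simp
    then obtain R where "P = [:-x, 1:] * ([:-x, 1:] * R)"
      unfolding power2_eq_square mult.assoc by (elim dvdE) (simp only: mult.assoc)
    then have "poly (pderiv P) x = 0"
      by (simp only: pderiv_mult) simp
    then show False
      by (simp add: pd)
  qed
  \<comment> \<open>The splitting into linear factors gives as many roots, counted with
    multiplicity, as the degree.\<close>
  obtain A where A: "size A = Polynomial.degree P" "P = smult (Polynomial.lead_coeff P) (\<Prod>x\<in>#A. [:-x, 1:])"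
    using alg_closed_imp_factorization[OF nz] by blast
  have "proots P = proots (smult (Polynomial.lead_coeff P) (\<Prod>x\<in>#A. [:-x, 1:]))"
    by (rule arg_cong[OF A(2), of proots])
  also have "\<dots> = proots (\<Prod>x\<in>#A. [:-x, 1:])"
    using nz by simp
  also have "\<dots> = A"
  proof -
    have "0 \<notin># image_mset (\<lambda>x. [:-x, 1:]) A"
      by auto
    from proots_prod_mset[OF this] show ?thesis
      by (simp add: image_mset.compositionality comp_def)
  qed
  finally have pA: "proots P = A" .
  have "size (proots P) = (\<Sum>x\<in>set_mset (proots P). count (proots P) x)"
    by (rule size_multiset_overloaded_eq)
  also have "\<dots> = (\<Sum>x\<in>set_mset (proots P). 1)"
  proof (intro sum.cong refl)
    fix x assume "x \<in> set_mset (proots P)"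
    then have "order x P \<noteq> 0"
      using nz by (simp add: order_root)
    with order_le[of x] show "count (proots P) x = 1"
      using nz by simp
  qed
  also have "\<dots> = card (subfield_ac m :: 'a alg_closure set)"
    using nz by (simp add: roots)
  finally show "card (subfield_ac m :: 'a alg_closure set) = ?Q"
    using pA A(1) deg by simp
  with Q1 show "finite (subfield_ac m :: 'a alg_closure set)"
    by (intro card_ge_0_finite) simp
qed

text \<open>A basis extension by counting: the span of \<open>N < m\<close> elements has at most \<open>q ^ N\<close> elements.\<close>

lemma independent_family_subfield_ac:
  assumes "N \<le> m" "m > 0"
  shows "\<exists>b. (\<forall>j<N. b j \<in> (subfield_ac m :: 'a::{field,finite} alg_closure set)) \<and>
    (\<forall>c. (\<Sum>j<N. to_ac (c j :: 'a) * b j) = 0 \<longrightarrow> (\<forall>j<N. c j = 0))"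
  using assms(1)
proof (induction N)
  case 0
  then show ?case by simp
next
  case (Suc N)
  then obtain b where b: "\<And>j. j < N \<Longrightarrow> b j \<in> (subfield_ac m :: 'a alg_closure set)"
    "\<And>c. (\<Sum>j<N. to_ac (c j :: 'a) * b j) = 0 \<Longrightarrow> (\<forall>j<N. c j = 0)"
    by auto
  let ?S = "(\<lambda>c. \<Sum>j<N. to_ac (c j :: 'a) * b j) ` ({..<N} \<rightarrow>\<^sub>E UNIV)"
  have "card ?S \<le> card ({..<N} \<rightarrow>\<^sub>E (UNIV :: 'a set))"
    by (intro card_image_le finite_PiE) auto
  also have "\<dots> = CARD('a) ^ N"
    by (simp add: card_PiE)
  also have "\<dots> < CARD('a) ^ m"
    using Suc.prems card_field_gt_1[where ?'a = 'a] by (intro power_strict_increasing) auto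
  finally have lt: "card ?S < card (subfield_ac m :: 'a alg_closure set)"
    using assms(2) by (simp add: card_subfield_ac)
  have "\<not> subfield_ac m \<subseteq> ?S"
  proof
    assume "subfield_ac m \<subseteq> ?S"
    then have "card (subfield_ac m :: 'a alg_closure set) \<le> card ?S"
      by (intro card_mono finite_imageI finite_PiE) auto
    with lt show False by simp
  qed
  then obtain v where v: "v \<in> subfield_ac m" "v \<notin> ?S"
    by blast
  have "\<forall>j<Suc N. c j = 0" if c: "(\<Sum>j<Suc N. to_ac (c j :: 'a) * (b(N := v)) j) = 0" for c
  proof -
    have c': "(\<Sum>j<N. to_ac (c j) * b j) + to_ac (c N) * v = 0"
      using c by simp
    have "c N = 0"
    proof (rule ccontr)
      \<comment> \<open>A nonzero coefficient would express \<open>v\<close> through the earlier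
        elements. \<open>restrict\<close> is there because \<open>?S\<close> is indexed by
        extensional functions.\<close>
      assume cN: "c N \<noteq> 0"
      have "v = - (\<Sum>j<N. to_ac (c j) * b j) / to_ac (c N)"
        using c' cN by (simp add: field_simps eq_neg_iff_add_eq_0)
      also have "\<dots> = (\<Sum>j<N. to_ac (restrict (\<lambda>j. - c j / c N) {..<N} j) * b j)"
        by (simp add: sum_divide_distrib sum_negf)
      finally have "v \<in> ?S"
        by (intro image_eqI[where x="restrict (\<lambda>j. - c j / c N) {..<N}"]) auto
      with v show False by simp
    qed
    with c' have "(\<Sum>j<N. to_ac (c j) * b j) = 0"
      by simp
    from b(2)[OF this] \<open>c N = 0\<close> show ?thesis
      by (metis less_Suc_eq)
  qed
  moreover have "\<forall>j<Suc N. (b(N := v)) j \<in> subfield_ac m"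
    using b(1) v(1) by (simp add: less_Suc_eq)
  ultimately show ?case by blast
qed

section \<open>Blocks and sphere packing\<close>

lemma block_carrier [simp]: "block N c i \<in> carrier_vec N"
  by (simp add: block_def)

lemma block_index_less:
  assumes "i < l" "j < (N :: nat)"
  shows "i * N + j < l * N"
proof -
  have "i * N + j < Suc i * N"
    using assms(2) by simp
  also have "\<dots> \<le> l * N"
    using assms(1) by (intro mult_le_mono1) simp
  finally show ?thesis .
qed

lemma
  fixes c d :: "'a::field vec"
  assumes "c \<in> carrier_vec (l * N)" "d \<in> carrier_vec (l * N)" "i < l"
  shows block_add: "block N (c + d) i = block N c i + block N d i"
    and block_diff: "block N (c - d) i = block N c i - block N d i"
  using assms block_index_less[OF assms(3)] by (auto simp: block_def intro!: eq_vecI)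

lemma block_smult:
  fixes c :: "'a::field vec"
  assumes "c \<in> carrier_vec (l * N)" "i < l"
  shows "block N (a \<cdot>\<^sub>v c) i = a \<cdot>\<^sub>v block N c i"
  using assms block_index_less[OF assms(2)] by (auto simp: block_def intro!: eq_vecI)

lemma block_zero: "i < l \<Longrightarrow> block N (0\<^sub>v (l * N)) i = 0\<^sub>v N"
  using block_index_less[of i l] by (auto simp: block_def intro!: eq_vecI)

lemma eq_zero_if_blocks_zero:
  assumes "c \<in> carrier_vec (l * N)" "\<And>i. i < l \<Longrightarrow> block N c i = 0\<^sub>v N"
  shows "c = 0\<^sub>v (l * N)"
proof (rule eq_vecI)
  fix t assume "t < dim_vec (0\<^sub>v (l * N) :: 'a vec)"
  then have t: "t < l * N" by simp
  then have "N > 0" by (cases N) auto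
  then have "t div N < l" "t mod N < N"
    using t by (simp_all add: less_mult_imp_div_less)
  moreover have "c $ t = block N c (t div N) $ (t mod N)"
    using \<open>t mod N < N\<close> by (simp add: block_def)
  ultimately show "c $ t = 0\<^sub>v (l * N) $ t"
    using assms(2) t by simp
qed (use assms in auto)

text \<open>Used both for the error patterns of weight one and for building preimages under the
  parity check map.\<close>

definition block_vec :: "nat \<Rightarrow> nat \<Rightarrow> nat \<Rightarrow> 'a::zero vec \<Rightarrow> 'a vec" where
  "block_vec l N i x = vec (l * N) (\<lambda>t. if t div N = i then x $ (t mod N) else 0)"

lemma block_vec_carrier [simp]: "block_vec l N i x \<in> carrier_vec (l * N)"
  by (simp add: block_vec_def)

lemma block_block_vec:
  assumes "i' < l" "x \<in> carrier_vec N"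
  shows "block N (block_vec l N i x) i' = (if i' = i then x else 0\<^sub>v N)"
  using assms block_index_less[OF assms(1)]
  by (auto simp: block_def block_vec_def intro!: eq_vecI)

lemma wt_SR_le_card:
  fixes c :: "'a::field vec"
  assumes "finite S" "\<And>i. i < l \<Longrightarrow> i \<notin> S \<Longrightarrow> block N c i = 0\<^sub>v N"
  shows "wt_SR l N c \<le> card S"
  unfolding wt_SR_eq_card using assms by (intro card_mono) auto

text \<open>If \<open>c + e = c' + e'\<close> with errors of weight at most one, then the codeword
  \<open>c - c'\<close> equals \<open>e' - e\<close> and lives on at most two blocks, hence is zero.
  So the sums of codewords and errors are distinct.\<close>

lemma sphere_packing_bound:
  fixes C :: "'a::{field,finite} vec set"
  assumes C: "linear_code (l * N) C" and d: "d_SR l N C \<ge> 3"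
  shows "card C * (l * (CARD('a) ^ N - 1) + 1) \<le> CARD('a) ^ (l * N)"
proof -
  let ?X = "{..<l} \<times> (carrier_vec N - {0\<^sub>v N :: 'a vec})"
  let ?e = "\<lambda>(i, x). block_vec l N i x"
  \<comment> \<open>The ball of radius one around zero.\<close>
  define E where "E = insert (0\<^sub>v (l * N)) (?e ` ?X)"
  have finX: "finite ?X"
    by (simp add: finite_carrier_vec)
  have "i = i' \<and> x = x'"
    if *: "i < l" "x \<in> carrier_vec N" "x \<noteq> 0\<^sub>v N" "x' \<in> carrier_vec N"
      "block_vec l N i x = block_vec l N i' x'" for i i' and x x' :: "'a vec"
  proof -
    from * have "x = (if i = i' then x' else 0\<^sub>v N)"
      using block_block_vec[of i l x N i] block_block_vec[of i l x' N i'] by simp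
    with * show ?thesis
      by presburger
  qed
  then have "inj_on ?e ?X"
    by (auto simp: inj_on_def)
  then have "card (?e ` ?X) = l * (CARD('a) ^ N - 1)"
    by (simp add: card_image card_cartesian_product card_Diff_singleton card_carrier_vec)
  moreover have "0\<^sub>v (l * N) \<notin> ?e ` ?X"
  proof
    assume "0\<^sub>v (l * N) \<in> ?e ` ?X"
    then obtain i and x :: "'a vec" where "i < l" "x \<in> carrier_vec N" "x \<noteq> 0\<^sub>v N" "0\<^sub>v (l * N) = block_vec l N i x"
      by auto
    then show False
      using block_block_vec[of i l x N i] block_zero[of i l N] by metis
  qed
  ultimately have card_E: "card E = l * (CARD('a) ^ N - 1) + 1"
    using finX by (simp add: E_def)
  have E_carrier: "E \<subseteq> carrier_vec (l * N)"
    by (auto simp: E_def)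
  have single: "\<exists>i. \<forall>i'<l. i' \<noteq> i \<longrightarrow> block N e i' = 0\<^sub>v N" if "e \<in> E" for e
    using that by (auto simp: E_def block_zero block_block_vec)
  have "inj_on (\<lambda>(c, e). c + e) (C \<times> E)"
  proof (rule inj_onI, clarify)
    fix c e c' e'
    assume *: "c \<in> C" "e \<in> E" "c' \<in> C" "e' \<in> E" "c + e = c' + e'"
    have carr: "c \<in> carrier_vec (l * N)" "c' \<in> carrier_vec (l * N)"
      "e \<in> carrier_vec (l * N)" "e' \<in> carrier_vec (l * N)"
      using * C E_carrier by (auto simp: linear_code_iff)
    have diff: "c - c' = e' - e"
    proof (rule eq_vecI)
      fix t assume "t < dim_vec (e' - e)"
      then have t: "t < l * N" using carr by simp
      have "(c + e) $ t = (c' + e') $ t"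
        using * by simp
      then have "c $ t + e $ t = c' $ t + e' $ t"
        using t carr by simp
      then have "c $ t - c' $ t = e' $ t - e $ t"
        by (simp add: algebra_simps)
      then show "(c - c') $ t = (e' - e) $ t"
        using t carr by simp
    qed (use carr in auto)
    have "c - c' = c + (-1) \<cdot>\<^sub>v c'"
      using carr by (intro eq_vecI) auto
    then have mem: "c - c' \<in> C"
      using C * by (simp add: linear_code_iff)
    obtain i i' where i: "\<And>j. j < l \<Longrightarrow> j \<noteq> i \<Longrightarrow> block N e j = 0\<^sub>v N"
      "\<And>j. j < l \<Longrightarrow> j \<noteq> i' \<Longrightarrow> block N e' j = 0\<^sub>v N"
      using single * by metis
    have "wt_SR l N (e' - e) \<le> card {i, i'}"
    proof (rule wt_SR_le_card)
      fix j assume "j < l" "j \<notin> {i, i'}"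
      then show "block N (e' - e) j = 0\<^sub>v N"
        using i carr by (auto simp: block_diff)
    qed simp
    also have "\<dots> < 3"
      by (simp add: card_insert_if)
    finally have "c - c' = 0\<^sub>v (l * N)"
      using d mem diff by (auto simp: d_SR_ge_3_iff)
    then have eq0: "(c - c') $ t = 0" "(e' - e) $ t = 0" if "t < l * N" for t
      using that diff by simp_all
    have "c = c'"
      using carr eq0(1) by (intro eq_vecI) auto
    moreover have "e = e'"
      using carr eq0(2) by (intro eq_vecI) auto
    ultimately show "c = c' \<and> e = e'" ..
  qed
  then have "card C * card E = card ((\<lambda>(c, e). c + e) ` (C \<times> E))"
    by (simp add: card_image card_cartesian_product)
  also have "\<dots> \<le> card (carrier_vec (l * N) :: 'a vec set)"
    using C E_carrier
    by (intro card_mono finite_carrier_vec) (auto simp: linear_code_iff subset_iff intro!: add_carrier_vec)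
  finally show ?thesis
    by (simp add: card_E card_carrier_vec)
qed

text \<open>All fibres of an additive map are translates of its kernel, so the domain has as many
  elements as image and kernel together as a product. It yields the redundancy of a code defined by
  parity checks.\<close>

lemma card_kernel:
  fixes \<Phi> :: "'a::{field,finite} vec \<Rightarrow> nat \<Rightarrow> 'b::ab_group_add"
  assumes add: "\<And>c d i. c \<in> carrier_vec n \<Longrightarrow> d \<in> carrier_vec n \<Longrightarrow> i < k \<Longrightarrow> \<Phi> (c + d) i = \<Phi> c i + \<Phi> d i"
    and range: "\<And>c i. c \<in> carrier_vec n \<Longrightarrow> i < k \<Longrightarrow> \<Phi> c i \<in> F i"
    and surj: "\<And>w. (\<And>i. i < k \<Longrightarrow> w i \<in> F i) \<Longrightarrow> \<exists>c\<in>carrier_vec n. \<forall>i<k. \<Phi> c i = w i"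
  shows "card {c \<in> carrier_vec n. \<forall>i<k. \<Phi> c i = 0} * (\<Prod>i<k. card (F i)) = CARD('a) ^ n"
proof -
  let ?K = "{c \<in> carrier_vec n. \<forall>i<k. \<Phi> c i = 0}"
  let ?W = "PiE {..<k} F"
  have "\<forall>w\<in>?W. \<exists>c\<in>carrier_vec n. \<forall>i<k. \<Phi> c i = w i"
    using surj by (auto simp: PiE_def Pi_def)
  \<comment> \<open>\<open>\<sigma>\<close> chooses one representative in each fibre.\<close>
  then obtain \<sigma> where \<sigma>: "\<And>w. w \<in> ?W \<Longrightarrow> \<sigma> w \<in> carrier_vec n"
    "\<And>w i. w \<in> ?W \<Longrightarrow> i < k \<Longrightarrow> \<Phi> (\<sigma> w) i = w i"
    by metis
  have cancel: "d - c + c = d" "c + d - c = d" if "c \<in> carrier_vec n" "d \<in> carrier_vec n" for c d :: "'a vec"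
    using that by (auto intro!: eq_vecI)
  have "bij_betw (\<lambda>(w, c). \<sigma> w + c) (?W \<times> ?K) (carrier_vec n)"
  proof (rule bij_betw_imageI)
    show "inj_on (\<lambda>(w, c). \<sigma> w + c) (?W \<times> ?K)"
    proof (rule inj_onI, clarify)
      fix w c w' c'
      assume *: "w \<in> ?W" "c \<in> carrier_vec n" "\<forall>i<k. \<Phi> c i = 0"
        "w' \<in> ?W" "c' \<in> carrier_vec n" "\<forall>i<k. \<Phi> c' i = 0" "\<sigma> w + c = \<sigma> w' + c'"
      have "w i = w' i" if "i < k" for i
      proof -
        have "\<Phi> (\<sigma> w + c) i = w i" "\<Phi> (\<sigma> w' + c') i = w' i"
          using *(1-6) that \<sigma> by (simp_all add: add)
        then show ?thesis
          using *(7) by simp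
      qed
      then have "w = w'"
        using *(1,4) by (intro PiE_ext[of w "{..<k}" F w']) auto
      moreover have "c = c'"
      proof -
        have "c = \<sigma> w + c - \<sigma> w"
          using \<sigma>(1)[OF *(1)] *(2) by (rule cancel(2)[symmetric])
        also have "\<dots> = \<sigma> w + c' - \<sigma> w"
          unfolding *(7) by (simp only: \<open>w = w'\<close>)
        also have "\<dots> = c'"
          using \<sigma>(1)[OF *(1)] *(5) by (rule cancel(2))
        finally show ?thesis .
      qed
      ultimately show "w = w' \<and> c = c'" ..
    qed
    show "(\<lambda>(w, c). \<sigma> w + c) ` (?W \<times> ?K) = carrier_vec n"
    proof (intro equalityI subsetI)
      fix d :: "'a vec" assume d: "d \<in> carrier_vec n"
      define w where "w = restrict (\<Phi> d) {..<k}"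
      have w: "w \<in> ?W"
        using range d by (auto simp: w_def)
      have "\<Phi> (d - \<sigma> w) i = 0" if "i < k" for i
      proof -
        have "\<Phi> (d - \<sigma> w + \<sigma> w) i = \<Phi> (d - \<sigma> w) i + \<Phi> (\<sigma> w) i"
          using d \<sigma>(1)[OF w] that by (intro add) auto
        then show ?thesis
          using that \<sigma>[OF w] d by (simp add: cancel w_def)
      qed
      then have "(w, d - \<sigma> w) \<in> ?W \<times> ?K"
        using w d \<sigma>(1)[OF w] by simp
      moreover have "d = \<sigma> w + (d - \<sigma> w)"
        using d \<sigma>(1)[OF w] by (auto intro!: eq_vecI)
      ultimately show "d \<in> (\<lambda>(w, c). \<sigma> w + c) ` (?W \<times> ?K)"
        by (intro image_eqI[where x = "(w, d - \<sigma> w)"]) auto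
    qed (use \<sigma> in auto)
  qed
  then have "card (?W \<times> ?K) = card (carrier_vec n :: 'a vec set)"
    by (rule bij_betw_same_card)
  then show ?thesis
    by (simp add: card_cartesian_product card_PiE card_carrier_vec mult.commute)
qed

section \<open>Codes from partial spreads\<close>

text \<open>Modelled on normalized representatives of projective points, with the leading 1 at
  position \<open>j\<close>, although the coordinates lie in different fields. Extensional functions
  keep the set countable by \<open>card_PiE\<close>.\<close>

definition normalized_ac :: "nat \<Rightarrow> (nat \<Rightarrow> nat) \<Rightarrow> nat \<Rightarrow> (nat \<Rightarrow> 'a::{field,finite} alg_closure) set" where
  "normalized_ac k m j =
     (\<Pi>\<^sub>E i\<in>{..<k}. if i < j then {0} else if i = j then {1} else subfield_ac (m i))"

lemma normalized_acD:
  assumes "a \<in> normalized_ac k m j" "i < k"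
  shows "i < j \<Longrightarrow> a i = 0" "i = j \<Longrightarrow> a i = 1" "a i \<in> subfield_ac (m i)"
proof -
  have *: "a i \<in> (if i < j then {0} else if i = j then {1} else subfield_ac (m i))"
    using PiE_mem[OF assms(1)[unfolded normalized_ac_def], of i] assms(2) by simp
  then show "i < j \<Longrightarrow> a i = 0" "i = j \<Longrightarrow> a i = 1"
    by auto
  show "a i \<in> subfield_ac (m i)"
    using * by (auto simp: subfield_ac_closed split: if_splits)
qed

lemma card_normalized_ac:
  assumes "j < k" "\<And>i. i < k \<Longrightarrow> m i > 0"
  shows "card (normalized_ac k m j :: (nat \<Rightarrow> 'a::{field,finite} alg_closure) set) =
    (\<Prod>i\<in>{j<..<k}. CARD('a) ^ m i)"
    and "finite (normalized_ac k m j :: (nat \<Rightarrow> 'a alg_closure) set)"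
proof -
  let ?A = "\<lambda>i. if i < j then {0} else if i = j then {1} else (subfield_ac (m i) :: 'a alg_closure set)"
  have "card (normalized_ac k m j :: (nat \<Rightarrow> 'a alg_closure) set) = (\<Prod>i<k. card (?A i))"
    by (simp add: normalized_ac_def card_PiE)
  also have "\<dots> = (\<Prod>i\<in>{j<..<k}. CARD('a) ^ m i)"
    using assms by (intro prod.mono_neutral_cong_right) (auto simp: card_subfield_ac)
  finally show "card (normalized_ac k m j :: (nat \<Rightarrow> 'a alg_closure) set) =
    (\<Prod>i\<in>{j<..<k}. CARD('a) ^ m i)" .
  show "finite (normalized_ac k m j :: (nat \<Rightarrow> 'a alg_closure) set)"
    unfolding normalized_ac_def using assms by (intro finite_PiE) (auto simp: card_subfield_ac)
qed

lemma card_UN_normalized_ac: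
  assumes "\<And>i. i < k \<Longrightarrow> m i > 0"
  shows "card (\<Union>j<k. normalized_ac k m j :: (nat \<Rightarrow> 'a::{field,finite} alg_closure) set) =
    (\<Sum>j<k. \<Prod>i\<in>{j<..<k}. CARD('a) ^ m i)"
proof -
  \<comment> \<open>The entries at position \<open>j\<close> are 1 and 0 respectively.\<close>
  have disj: "normalized_ac k m j \<inter> normalized_ac k m j' = ({} :: (nat \<Rightarrow> 'a alg_closure) set)"
    if "j < j'" "j < k" for j j'
    using that normalized_acD(2)[of _ k m j j] normalized_acD(1)[of _ k m j' j] by fastforce
  have "card (\<Union>j<k. normalized_ac k m j :: (nat \<Rightarrow> 'a alg_closure) set) =
      (\<Sum>j<k. card (normalized_ac k m j :: (nat \<Rightarrow> 'a alg_closure) set))"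
  proof (rule card_UN_disjoint)
    show "\<forall>i\<in>{..<k}. \<forall>j\<in>{..<k}. i \<noteq> j \<longrightarrow>
        normalized_ac k m i \<inter> normalized_ac k m j = ({} :: (nat \<Rightarrow> 'a alg_closure) set)"
      using disj by (metis Int_commute lessThan_iff linorder_neqE_nat)
  qed (use assms in \<open>auto intro: card_normalized_ac\<close>)
  then show ?thesis
    using assms by (simp add: card_normalized_ac)
qed

text \<open>The parity check map on block \<open>t\<close> is \<open>x \<mapsto> (a 0 * \<theta> 0 x, \<dots>, a (k - 1) * \<theta> (k - 1) x)\<close>, where
  \<open>a\<close> is the \<open>t\<close>-th normalized vector. Its images form a partial spread, and they span because
  \<open>\<theta> 0\<close> is onto.\<close>

lemma exists_partial_spread_code:
  fixes m :: "nat \<Rightarrow> nat" and k N :: nat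
  defines "L \<equiv> \<Sum>j<k. \<Prod>i\<in>{j<..<k}. CARD('a::{field,finite}) ^ m i"
  assumes N: "N \<ge> 1" and k: "k \<ge> 1" and m0: "m 0 = N" and mN: "\<And>i. i < k \<Longrightarrow> N \<le> m i"
  shows "\<exists>C :: 'a vec set. linear_code (L * N) C \<and> d_SR L N C \<ge> 3 \<and>
    redundancy (L * N) C = (\<Sum>i<k. m i)"
proof -

  \<comment> \<open>Linear embeddings of the block space into the fields\<close>
  let ?F = "\<lambda>i. subfield_ac (m i) :: 'a alg_closure set"
  have mpos: "\<And>i. i < k \<Longrightarrow> m i > 0"
    using mN N by fastforce
  have "\<forall>i. \<exists>b. i < k \<longrightarrow> (\<forall>j<N. b j \<in> ?F i) \<and>
      (\<forall>c. (\<Sum>j<N. to_ac (c j :: 'a) * b j) = 0 \<longrightarrow> (\<forall>j<N. c j = 0))"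
    using independent_family_subfield_ac[OF mN mpos] by blast
  then obtain b where b: "\<And>i j. i < k \<Longrightarrow> j < N \<Longrightarrow> b i j \<in> ?F i"
    "\<And>i c j. i < k \<Longrightarrow> (\<Sum>j<N. to_ac (c j :: 'a) * b i j) = 0 \<Longrightarrow> j < N \<Longrightarrow> c j = 0"
    by metis
  define \<theta> where "\<theta> i x = (\<Sum>j<N. to_ac (x $ j :: 'a) * b i j)" for i and x :: "'a vec"
  have \<theta>_add: "\<theta> i (x + y) = \<theta> i x + \<theta> i y" if "x \<in> carrier_vec N" "y \<in> carrier_vec N" for i x y
    using that by (simp add: \<theta>_def distrib_right sum.distrib)
  have \<theta>_smult: "\<theta> i (a \<cdot>\<^sub>v x) = to_ac a * \<theta> i x" if "x \<in> carrier_vec N" for i a x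
    using that by (simp add: \<theta>_def sum_distrib_left mult.assoc)
  have \<theta>_zero [simp]: "\<theta> i (0\<^sub>v N) = 0" for i
    by (simp add: \<theta>_def)
  have \<theta>_uminus: "\<theta> i (- x) = - \<theta> i x" if "x \<in> carrier_vec N" for i x
    using that by (simp add: \<theta>_def sum_negf)
  have \<theta>_in: "\<theta> i x \<in> ?F i" if "i < k" for i x
    unfolding \<theta>_def using b(1) that by (intro subfield_ac_sum subfield_ac_closed(6,1)) auto
  have \<theta>_eq_0: "x = 0\<^sub>v N" if "i < k" "x \<in> carrier_vec N" "\<theta> i x = 0" for i x
  proof (rule eq_vecI)
    fix j assume "j < dim_vec (0\<^sub>v N :: 'a vec)"
    then have "j < N"
      by simp
    then show "x $ j = 0\<^sub>v N $ j"
      using b(2)[OF that(1) that(3)[unfolded \<theta>_def]] by simp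
  qed (use that in simp)
  have \<theta>_eq: "x = y" if "i < k" "x \<in> carrier_vec N" "y \<in> carrier_vec N" "\<theta> i x = \<theta> i y" for i x y
  proof -
    have "\<theta> i (x + - y) = 0"
      using that by (simp add: \<theta>_add \<theta>_uminus)
    moreover have "x + - y \<in> carrier_vec N"
      using that by simp
    ultimately have "x + - y = 0\<^sub>v N"
      using \<theta>_eq_0[OF that(1)] by blast
    then have 0: "(x + - y) $ j = 0" if "j < N" for j
      using that by simp
    show ?thesis
    proof (rule eq_vecI)
      show "x $ j = y $ j" if "j < dim_vec y" for j
        using 0[of j] that \<open>x \<in> carrier_vec N\<close> \<open>y \<in> carrier_vec N\<close> by simp
    qed (use that in simp)
  qed
  have \<theta>_surj: "\<exists>x\<in>carrier_vec N. \<theta> 0 x = y" if "y \<in> ?F 0" for y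
  proof -
    \<comment> \<open>Because \<open>m 0 = N\<close>, \<open>\<theta> 0\<close> is an injection
      between finite sets of equal size.\<close>
    have "\<theta> 0 ` carrier_vec N = ?F 0"
    proof (rule card_subset_eq)
      have "inj_on (\<theta> 0) (carrier_vec N)"
        using \<theta>_eq[of 0] k by (auto simp: inj_on_def)
      then show "card (\<theta> 0 ` carrier_vec N) = card (?F 0)"
        using N by (simp add: card_image card_carrier_vec m0 card_subfield_ac)
    qed (use \<theta>_in k mpos in \<open>auto simp: card_subfield_ac\<close>)
    then have "y \<in> \<theta> 0 ` carrier_vec N"
      using that by simp
    then show ?thesis
      by blast
  qed

  \<comment> \<open>Enumeration of the normalized vectors; the partial spread property\<close>
  let ?I = "\<Union>j<k. normalized_ac k m j :: (nat \<Rightarrow> 'a alg_closure) set"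
  have "finite ?I"
    using mpos by (auto intro: card_normalized_ac)
  moreover have "card ?I = L"
    unfolding L_def using mpos by (rule card_UN_normalized_ac)
  ultimately obtain g where g: "bij_betw g {..<L} ?I"
    using ex_bij_betw_nat_finite[of ?I] by (auto simp: atLeast0LessThan)
  have gI: "\<exists>j<k. g t \<in> normalized_ac k m j" if "t < L" for t
    using bij_betwE[OF g] that by auto
  have g_in: "g t i \<in> ?F i" if "t < L" "i < k" for t i
    using gI[OF that(1)] normalized_acD(3) that(2) by blast
  \<comment> \<open>Each block map is injective, since the coordinate of the leading 1 is a plain
    \<open>\<theta> j x\<close>.\<close>
  have single: "x = 0\<^sub>v N"
    if t: "t < L" and x: "x \<in> carrier_vec N" and eq: "\<And>i. i < k \<Longrightarrow> g t i * \<theta> i x = 0" for t x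
  proof -
    obtain j where j: "j < k" "g t \<in> normalized_ac k m j"
      using gI[OF t] by blast
    have "\<theta> j x = 0"
      using normalized_acD(2)[OF j(2,1) refl] eq[OF j(1)] by simp
    then show ?thesis
      by (rule \<theta>_eq_0[OF j(1) x])
  qed
  \<comment> \<open>With different leading positions, coordinate \<open>j\<close> equates
    \<open>\<theta> j x\<close> with 0.\<close>
  have pair_less: "x = 0\<^sub>v N"
    if t: "t < L" "t' < L" and x: "x \<in> carrier_vec N" and a: "g t \<in> normalized_ac k m j"
      "g t' \<in> normalized_ac k m j'" "j < j'" "j < k"
      and eq: "\<And>i. i < k \<Longrightarrow> g t i * \<theta> i x = g t' i * \<theta> i y" for t t' x y j j'
    using eq[of j] normalized_acD(2)[of "g t" k m j j] normalized_acD(1)[of "g t'" k m j' j] a x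
      \<theta>_eq_0[of j x] by simp
  have pair: "x = 0\<^sub>v N"
    if t: "t < L" "t' < L" "t \<noteq> t'" and x: "x \<in> carrier_vec N" "y \<in> carrier_vec N"
      and eq: "\<And>i. i < k \<Longrightarrow> g t i * \<theta> i x = g t' i * \<theta> i y" for t t' x y
  proof -
    obtain j j' where j: "j < k" "g t \<in> normalized_ac k m j" "j' < k" "g t' \<in> normalized_ac k m j'"
      using gI[OF t(1)] gI[OF t(2)] by metis
    consider "j < j'" | "j' < j" | "j = j'"
      by linarith
    then show ?thesis
    proof cases
      case 1
      then show ?thesis
        using pair_less[OF t(1,2) x(1) j(2,4)] j eq by blast
    next
      case 2
      \<comment> \<open>With the roles exchanged \<open>y\<close> vanishes first; then
        \<open>single\<close> applies to \<open>x\<close>.\<close>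
      then have "y = 0\<^sub>v N"
        using pair_less[OF t(2,1) x(2) j(4,2), of x] j eq by force
      then show ?thesis
        using single[OF t(1) x(1)] eq by simp
    next
      case 3
      \<comment> \<open>A common leading position forces \<open>x = y\<close>. If \<open>x\<close>
        were nonzero, every \<open>\<theta> i x\<close> could be cancelled, making the two
        normalized vectors equal.\<close>
      have "\<theta> j x = \<theta> j y"
        using eq[OF j(1)] normalized_acD(2)[OF j(2,1) refl]
          normalized_acD(2)[OF j(4) j(1) \<open>j = j'\<close>] by simp
      then have "x = y"
        by (rule \<theta>_eq[OF j(1) x])
      show ?thesis
      proof (rule ccontr)
        assume "x \<noteq> 0\<^sub>v N"
        then have "g t i = g t' i" if "i < k" for i
          using eq[OF that] \<theta>_eq_0[of i x] that x \<open>x = y\<close> by auto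
        then have "g t = g t'"
          using j unfolding normalized_ac_def by (intro PiE_ext[of "g t" "{..<k}" _ "g t'"]) auto
        then show False
          using t inj_onD[OF bij_betw_imp_inj_on[OF g], of t t'] by simp
      qed
    qed
  qed

  \<comment> \<open>The parity check map: linearity and surjectivity\<close>
  define \<Phi> where "\<Phi> c i = (\<Sum>t<L. g t i * \<theta> i (block N c t))" for c i
  have \<Phi>_add: "\<Phi> (c + d) i = \<Phi> c i + \<Phi> d i"
    if "c \<in> carrier_vec (L * N)" "d \<in> carrier_vec (L * N)" for c d i
    using that by (simp add: \<Phi>_def block_add \<theta>_add distrib_left sum.distrib)
  have \<Phi>_smult: "\<Phi> (a \<cdot>\<^sub>v c) i = to_ac a * \<Phi> c i" if "c \<in> carrier_vec (L * N)" for a c i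
    using that by (simp add: \<Phi>_def block_smult \<theta>_smult sum_distrib_left mult.left_commute)
  have \<Phi>_zero: "\<Phi> (0\<^sub>v (L * N)) i = 0" for i
    by (simp add: \<Phi>_def block_zero)
  have \<Phi>_in: "\<Phi> c i \<in> ?F i" if "i < k" for c i
    unfolding \<Phi>_def using g_in \<theta>_in that by (intro subfield_ac_sum subfield_ac_closed(6)) auto
  have \<Phi>_block_vec: "\<Phi> (block_vec L N t x) i = g t i * \<theta> i x"
    if "t < L" "x \<in> carrier_vec N" for t x i
  proof -
    have "\<Phi> (block_vec L N t x) i = (\<Sum>t'<L. if t' = t then g t i * \<theta> i x else 0)"
      unfolding \<Phi>_def using that by (intro sum.cong refl) (simp add: block_block_vec)
    then show ?thesis
      using that by simp
  qed
  have \<Phi>_surj: "\<exists>c\<in>carrier_vec (L * N). \<forall>i<k. \<Phi> c i = w i" if w: "\<And>i. i < k \<Longrightarrow> w i \<in> ?F i" for w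
  proof -
    define x where "x = (vec N (\<lambda>_. 1) :: 'a vec)"
    have x: "x \<in> carrier_vec N"
      by (simp add: x_def)
    have "x $ 0 \<noteq> 0\<^sub>v N $ 0"
      using N by (simp add: x_def)
    then have x0: "x \<noteq> 0\<^sub>v N"
      by blast
    have \<theta>x: "\<theta> i x \<noteq> 0" if "i < k" for i
      using \<theta>_eq_0[OF that x] x0 by blast
    \<comment> \<open>The block of \<open>a\<close>, filled with \<open>x\<close>, produces every
      coordinate of \<open>w\<close> except coordinate 0, where normalization forces entry 1. The
      block of \<open>e\<close> affects only coordinate 0 and corrects it, as
      \<open>\<theta> 0\<close> is onto. If the two blocks coincide, additivity still
      applies.\<close>
    define a where "a = (\<lambda>i\<in>{..<k}. if i = 0 then 1 else w i / \<theta> i x)"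
    define e where "e = (\<lambda>i\<in>{..<k}. if i = 0 then 1 else 0 :: 'a alg_closure)"
    have "a \<in> normalized_ac k m 0" "e \<in> normalized_ac k m 0"
      unfolding normalized_ac_def a_def e_def
      using w \<theta>_in by (auto simp: subfield_ac_closed)
    then have "a \<in> ?I" "e \<in> ?I"
      using k by auto
    then have "a \<in> g ` {..<L}" "e \<in> g ` {..<L}"
      by (simp_all only: bij_betw_imp_surj_on[OF g])
    then obtain t t' where t: "t < L" "g t = a" "t' < L" "g t' = e"
      by blast
    obtain y where y: "y \<in> carrier_vec N" "\<theta> 0 y = w 0 - \<theta> 0 x"
      using \<theta>_surj[of "w 0 - \<theta> 0 x"] w \<theta>_in k by (auto simp: subfield_ac_closed)
    have "\<Phi> (block_vec L N t x + block_vec L N t' y) i = w i" if "i < k" for i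
    proof -
      have "\<Phi> (block_vec L N t x + block_vec L N t' y) i = a i * \<theta> i x + e i * \<theta> i y"
        using t x y by (simp add: \<Phi>_add \<Phi>_block_vec)
      also have "\<dots> = w i"
        using that \<theta>x[OF that] y by (simp add: a_def e_def)
      finally show ?thesis .
    qed
    then show ?thesis
      by (intro bexI[of _ "block_vec L N t x + block_vec L N t' y"]) auto
  qed

  \<comment> \<open>The kernel as a code and its redundancy\<close>
  define C where "C = {c \<in> carrier_vec (L * N). \<forall>i<k. \<Phi> c i = 0}"
  have lin: "linear_code (L * N) C"
    unfolding linear_code_iff
  proof (intro conjI ballI allI)
    show "0\<^sub>v (L * N) \<in> C"
      by (simp add: C_def \<Phi>_zero)
    show "x + y \<in> C" if "x \<in> C" "y \<in> C" for x y
      using that by (simp add: C_def \<Phi>_add)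
    show "a \<cdot>\<^sub>v x \<in> C" if "x \<in> C" for a x
      using that by (simp add: C_def \<Phi>_smult)
  qed (simp add: C_def)
  have "(\<Prod>i<k. card (?F i)) = CARD('a) ^ (\<Sum>i<k. m i)"
    using mpos by (simp add: card_subfield_ac power_sum)
  moreover have "card C * (\<Prod>i<k. card (?F i)) = CARD('a) ^ (L * N)"
    unfolding C_def by (rule card_kernel) (use \<Phi>_add \<Phi>_in \<Phi>_surj in blast)+
  \<comment> \<open>Two counts of the ambient space, by redundancy and by the fibres of
    \<open>\<Phi>\<close>; comparing exponents of q gives the redundancy.\<close>
  ultimately have "card C * CARD('a) ^ redundancy (L * N) C = card C * CARD('a) ^ (\<Sum>i<k. m i)"
    using card_linear_code_redundancy[OF lin] by simp
  moreover have "card C \<noteq> 0"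
    using lin card_linear_code(2)[OF lin] by (auto simp: linear_code_iff)
  ultimately have "CARD('a) ^ redundancy (L * N) C = CARD('a) ^ (\<Sum>i<k. m i)"
    by simp
  then have red: "redundancy (L * N) C = (\<Sum>i<k. m i)"
    using power_inject_exp[OF card_field_gt_1[where ?'a = 'a]] by blast

  \<comment> \<open>Minimum distance at least three\<close>
  have "wt_SR L N c \<ge> 3" if c: "c \<in> C" "c \<noteq> 0\<^sub>v (L * N)" for c
  proof (rule ccontr)
    let ?S = "{i. i < L \<and> block N c i \<noteq> 0\<^sub>v N}"
    assume "\<not> wt_SR L N c \<ge> 3"
    then have card_S: "card ?S \<le> 2"
      by (simp add: wt_SR_eq_card)
    have carr: "c \<in> carrier_vec (L * N)"
      using c(1) by (simp add: C_def)
    obtain t where t: "t \<in> ?S"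
      using eq_zero_if_blocks_zero[OF carr] c(2) by blast
    have sum_S: "(\<Sum>t\<in>?S. g t i * \<theta> i (block N c t)) = 0" if "i < k" for i
    proof -
      have "\<Phi> c i = (\<Sum>t\<in>?S. g t i * \<theta> i (block N c t))"
        unfolding \<Phi>_def by (rule sum.mono_neutral_right) auto
      then show ?thesis
        using c(1) that by (simp add: C_def)
    qed
    show False
    proof (cases "?S = {t}")
      case True
      have "block N c t = 0\<^sub>v N"
      proof (rule single)
        show "g t i * \<theta> i (block N c t) = 0" if "i < k" for i
          using sum_S[OF that] unfolding True by simp
      qed (use t in auto)
      then show False
        using t by simp
    next
      case False
      then obtain t' where t': "t' \<in> ?S" "t' \<noteq> t"
        using t by blast
      have "?S = {t, t'}"
        using t t' card_S by (intro card_seteq[symmetric]) auto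
      then have *: "g t i * \<theta> i (block N c t) + g t' i * \<theta> i (block N c t') = 0" if "i < k" for i
        using sum_S[OF that] t'(2) by simp
      have "block N c t = 0\<^sub>v N"
      proof (rule pair)
        fix i assume "i < k"
        \<comment> \<open>The sign is moved into the block, turning the vanishing sum into a common
          point of two spread elements.\<close>
        then show "g t i * \<theta> i (block N c t) = g t' i * \<theta> i (- block N c t')"
          using *[of i] by (simp add: \<theta>_uminus eq_neg_iff_add_eq_0)
      qed (use t t' in auto)
      then show False
        using t by simp
    qed
  qed
  then have "d_SR L N C \<ge> 3"
    by (simp add: d_SR_ge_3_iff)
  with lin red show ?thesis
    by blast
qed

section \<open>The bounds\<close>

text \<open>Modulo q^N - 1 the number q^(k*N+s) is congruent to q^s, and q^s - 1 is smaller than the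
  modulus. As \<open>l\<close> is an integer, the packing inequality can be rounded down to the
  sharper one.\<close>

lemma upper_bound_arith:
  fixes q :: nat
  assumes q: "q > 1" and N: "N \<ge> 1" and s: "s < N" and le: "l * (q ^ N - 1) + 1 \<le> q ^ (k * N + s)"
  shows "l * (q ^ N - 1) + q ^ s \<le> q ^ (k * N + s)"
proof -
  let ?M = "q ^ N - 1"
  have "q ^ s < q ^ N"
    using q s by (intro power_strict_increasing)
  then have qs: "q ^ s - 1 < ?M" "q ^ s \<ge> 1"
    using q by (simp_all add: diff_less_mono)
  \<comment> \<open>Factorization of y^k - 1 at y = q^N, carried out over the integers.\<close>
  have "?M dvd q ^ (k * N) - 1"
  proof -
    have "int ?M dvd int (q ^ (k * N) - 1)"
      using q power_diff_1_eq[of "int q ^ N" k]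
      by (simp add: of_nat_diff power_mult mult.commute[of k] dvd_def) 
    then show ?thesis
      by (simp only: int_dvd_int_iff)
  qed
  then obtain T where T: "q ^ (k * N) - 1 = ?M * T" ..
  have "q ^ (k * N) \<ge> 1"
    using q by simp
  then have "q ^ (k * N) = ?M * T + 1"
    using T by linarith
  then have eq: "q ^ (k * N + s) = ?M * (T * q ^ s) + q ^ s"
    by (simp add: power_add algebra_simps)
  have "l * ?M \<le> ?M * (T * q ^ s) + (q ^ s - 1)"
    using le qs(2) unfolding eq by linarith
  also have "\<dots> < ?M * (T * q ^ s) + ?M"
    using qs(1) by simp
  also have "\<dots> = Suc (T * q ^ s) * ?M"
    by simp
  finally have "l < Suc (T * q ^ s)"
    by (simp only: mult_less_cancel2)
  then have "l * ?M \<le> (T * q ^ s) * ?M"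
    by (intro mult_le_mono1) simp
  then show ?thesis
    unfolding eq by (simp add: mult.commute)
qed

text \<open>The quotient is the geometric sum of q^(i*N+s) over i < k; subtracting q^s and adding 1
  replaces its first term by 1. Increasing \<open>k\<close> adds one new product, at j = 0, and
  shifts the others.\<close>

lemma spread_size_arith:
  fixes q :: nat
  assumes q: "q > 1" and N: "N \<ge> 1" and k: "k \<ge> 1"
  shows "real (\<Sum>j<k. \<Prod>i\<in>{j<..<k}. q ^ (if i = k - 1 then N + s else N)) =
    (real q ^ (k * N + s) - real q ^ s) / (real q ^ N - 1) - real q ^ s + 1"
  using k
proof (induction k rule: dec_induct)
  case base
  have "real q ^ N > 1"
    using q N by (simp add: one_less_power)
  then show ?case
    by (simp add: power_add field_simps)
next
  case (step k)
  let ?f = "\<lambda>k j. \<Prod>i\<in>{j<..<k}. q ^ (if i = k - 1 then N + s else N)"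
  have gt: "real q ^ N > 1"
    using q N by (simp add: one_less_power)
  have "(\<Sum>j<Suc k. ?f (Suc k) j) = ?f (Suc k) 0 + (\<Sum>j<k. ?f (Suc k) (Suc j))"
    by (rule sum.lessThan_Suc_shift)
  also have "(\<Sum>j<k. ?f (Suc k) (Suc j)) = (\<Sum>j<k. ?f k j)"
  proof (intro sum.cong refl)
    fix j assume "j \<in> {..<k}"
    show "?f (Suc k) (Suc j) = ?f k j"
      \<comment> \<open>The shift by one keeps the enlarged field in last position.\<close>
      using step by (intro prod.reindex_bij_witness[of _ Suc "\<lambda>i. i - 1"]) auto
  qed
  also have "?f (Suc k) 0 = q ^ (k * N + s)"
  proof -
    have "{0<..<Suc k} = insert k {0<..<k}"
      using step by auto
    then have "?f (Suc k) 0 = q ^ (N + s) * (\<Prod>i\<in>{0<..<k}. q ^ N)"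
      by simp
    also have "\<dots> = q ^ (N + s + N * (k - 1))"
      by (simp add: power_add power_mult)
    also have "N + s + N * (k - 1) = k * N + s"
      using step by (cases k) auto
    finally show ?thesis .
  qed
  finally show ?case
    using step.IH gt by (simp add: power_add field_simps)
qed

theorem corollary13:
  fixes C :: "'a::{field,finite} vec set"
    and q l N n r s :: nat
  assumes "q = card (UNIV :: 'a set)"
    and "l \<ge> 1" and "N \<ge> 1" and "n = l * N"
    and "r \<ge> N" and "s = r mod N"
    and "proper_sum_rank_Hamming_code l N C"
    and "r = redundancy n C"
  shows "real N * ((real q ^ r - real q ^ s) / (real q ^ N - 1) - real q ^ s + 1) \<le> real n
       \<and> real n \<le> real N * ((real q ^ r - real q ^ s) / (real q ^ N - 1))
       \<and> (s = 0 \<longrightarrow>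
            real N * ((real q ^ r - real q ^ s) / (real q ^ N - 1) - real q ^ s + 1) = real n
          \<and> real n = real N * ((real q ^ r - real q ^ s) / (real q ^ N - 1)))"
proof -
  define k where "k = r div N"
  have r: "r = k * N + s" and s: "s < N" and k: "k \<ge> 1"
    using assms(3,5,6) by (simp_all add: k_def div_greater_zero_iff Suc_le_eq)
  have q: "q > 1"
    unfolding assms(1) by (rule card_field_gt_1)
  have qN: "q ^ N > 1"
    using q assms(3) by (intro one_less_power) auto
  then have qN': "real q ^ N > 1"
    by (metis of_nat_1 of_nat_less_iff of_nat_power)
  have C: "linear_code (l * N) C" "d_SR l N C \<ge> 3"
    and maximal: "\<And>l' (C' :: 'a vec set). l' > l \<Longrightarrow> linear_code (l' * N) C' \<Longrightarrow> d_SR l' N C' \<ge> 3 \<Longrightarrow>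
      redundancy (l' * N) C' \<noteq> r"
    using assms(7) unfolding assms(8) assms(4) proper_sum_rank_Hamming_code_def by blast+

  \<comment> \<open>Upper bound\<close>
  have "card C * q ^ r = q ^ (l * N)"
    using card_linear_code_redundancy[OF C(1)] unfolding assms(1,4,8) .
  then have "card C * (l * (q ^ N - 1) + 1) \<le> card C * q ^ r"
    using sphere_packing_bound[OF C] unfolding assms(1) by simp
  moreover have "0 < card C"
    using C(1) card_linear_code(2)[OF C(1)] by (auto simp: card_gt_0_iff linear_code_iff)
  ultimately have "l * (q ^ N - 1) + 1 \<le> q ^ (k * N + s)"
    unfolding r mult_le_cancel1 by blast
  then have "l * (q ^ N - 1) + q ^ s \<le> q ^ r"
    unfolding r by (rule upper_bound_arith[OF q assms(3) s])
  then have "real (l * (q ^ N - 1) + q ^ s) \<le> real (q ^ r)"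
    by (simp only: of_nat_le_iff)
  then have "real l * (real q ^ N - 1) + real q ^ s \<le> real q ^ r"
    using qN by (simp add: of_nat_diff)
  then have upper: "real l \<le> (real q ^ r - real q ^ s) / (real q ^ N - 1)"
    using qN' by (simp add: pos_le_divide_eq)

  \<comment> \<open>Lower bound by maximality, and the case of equality\<close>
  define m where "m i = (if i = k - 1 then N + s else N)" for i
  define L where "L = (\<Sum>j<k. \<Prod>i\<in>{j<..<k}. q ^ m i)"
  have L: "real L = (real q ^ r - real q ^ s) / (real q ^ N - 1) - real q ^ s + 1"
    unfolding L_def m_def r by (rule spread_size_arith[OF q assms(3) k])
  have "L \<le> l"
  \<comment> \<open>For k = 1 the sum \<open>L\<close> is 1, and \<open>l \<ge> 1\<close> suffices.
    Otherwise index 0 differs from the enlarged index k - 1, so \<open>m 0 = N\<close> as the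
    construction requires.\<close>
  proof (cases "k = 1")
    case True
    moreover have "{0<..<Suc 0} = {}"
      by auto
    ultimately show ?thesis
      using assms(2) by (simp add: L_def)
  next
    case False
    show ?thesis
    proof (rule ccontr)
      \<comment> \<open>The constructed code would have more blocks and the same redundancy
        \<open>r\<close>, against properness.\<close>
      assume "\<not> L \<le> l"
      moreover have "\<exists>C' :: 'a vec set. linear_code (L * N) C' \<and> d_SR L N C' \<ge> 3 \<and>
          redundancy (L * N) C' = (\<Sum>i<k. m i)"
        unfolding L_def assms(1) using assms(3) k False
        by (intro exists_partial_spread_code) (auto simp: m_def)
      moreover have "(\<Sum>i<k. m i) = r"
      proof -
        have "(\<Sum>i<Suc (k - 1). m i) = (\<Sum>i<k - 1. N) + (N + s)"
          by (simp add: m_def)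
        then show ?thesis
          using k by (cases k) (simp_all add: r)
      qed
      ultimately show False
        using maximal[of L] by auto
    qed
  qed
  then have lower: "(real q ^ r - real q ^ s) / (real q ^ N - 1) - real q ^ s + 1 \<le> real l"
    unfolding L[symmetric] by simp
  have n: "real n = real N * real l"
    by (simp add: assms(4))
  show ?thesis
    unfolding n
  proof (intro conjI impI)
    show "real N * ((real q ^ r - real q ^ s) / (real q ^ N - 1) - real q ^ s + 1) \<le> real N * real l"
      using lower by (rule mult_left_mono) simp
    show "real N * real l \<le> real N * ((real q ^ r - real q ^ s) / (real q ^ N - 1))"
      using upper by (rule mult_left_mono) simp
    \<comment> \<open>Here q^s = 1, so the correction -q^s + 1 vanishes and both bounds on
      \<open>l\<close> coincide.\<close>
    assume "s = 0"
    then have "(real q ^ r - real q ^ s) / (real q ^ N - 1) = real l"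
      using lower upper by simp
    then show "real N * ((real q ^ r - real q ^ s) / (real q ^ N - 1) - real q ^ s + 1) = real N * real l"
      and "real N * real l = real N * ((real q ^ r - real q ^ s) / (real q ^ N - 1))"
      using \<open>s = 0\<close> by simp_all
  qed
qed

end
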